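(* Let $\kappa$ be an infinite cardinal, $T$ a complete first-order theory with monster model $\mathcal U$, $M\prec\mathcal U$ a model of $T$ and $\phi(x;y)$ an NIP formula, where both $M$ and $T$ have size at most $\kappa$. Let $p\in \mathrm{Inv}_\phi(M)$. Then the function $d_p : S_y(M)\to\{0,1\}$ is in $B_r^{\S}(S_y(M))$.
   Context: $\mathcal U$ is a monster model of $T$ (sufficiently saturated and strongly homogeneous), and $M$ is a small elementary submodel. $x$ and $y$ are finite tuples of variables. A formula $\phi(x;y)$ is NIP if there do not exist, in $\mathcal U$, an infinite set $A$ of $|x|$-tuples and, for each $I\subseteq A$, a $|y|$-tuple $b_I$ such that for all $a\in A$: $\mathcal U\models \phi(a;b_I) \iff a\in I$. $S_y(M)$ is the space of complete types over $M$ in the variable $y$, with the Stone topology. $S_\phi(\mathcal U)$ is the space of global $\phi$-types, i.e. maximal consistent sets of formulas of the form $\phi(x;b)$ or $\neg\phi(x;b)$, $b\in\mathcal U$. A global $\phi$-type $p$ is $M$-invariant if whenever $b,b'\in\mathcal U$ have the same type over $M$, $p\vdash\phi(x;b)$ if and only if $p\vdash \phi(x;b')$. $\mathrm{Inv}_\phi(M)\subseteq S_\phi(\mathcal U)$ is the space of global $M$-invariant $\phi$-types. For $p\in \mathrm{Inv}_\phi(M)$, the function $d_p:S_y(M)\to\{0,1\}$ is defined by $d_p(q)=1$ if $p\vdash\phi(x;b)$ for some (equivalently any) $b\in q(\mathcal U)$, and $d_p(q)=0$ otherwise. For a topological space $X$, $B^{\S}(X)$ is the set of functions $f:X\to\{0,1\}$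 such that $\overline{f^{-1}(0)}\cap\overline{f^{-1}(1)}$ has empty interior. $B_r^{\S}(X)$ is the set of functions $f:X\to\{0,1\}$ such that $f|_F\in B^{\S}(F)$ for every closed non-empty $F\subseteq X$ (closures and interiors being taken in $F$ with the induced topology). *)

theory Defs
  imports "HOL-Analysis.Analysis"
begin

unbundle cardinal_syntax

section \<open>First-order syntax with parameters\<close>

record ('f, 'r) lang =
  fun_syms :: "'f set"
  rel_syms :: "'r set"
  fun_arity :: "'f \<Rightarrow> nat"
  rel_arity :: "'r \<Rightarrow> nat"

text \<open>Variables are natural numbers.  \<open>Par c\<close> is a constant naming the element \<open>c\<close>; an
  L(A)-formula is one whose parameters all lie in A, and an L-formula is an L({})-formula.\<close>

datatype ('f, 'a) tm = Var nat | Par 'a | Fn 'f "('f, 'a) tm list"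

datatype ('f, 'r, 'a) fm =
    Eq "('f, 'a) tm" "('f, 'a) tm"
  | Rel 'r "('f, 'a) tm list"
  | Neg "('f, 'r, 'a) fm"
  | And "('f, 'r, 'a) fm" "('f, 'r, 'a) fm"
  | Ex nat "('f, 'r, 'a) fm"

fun wf_tm :: "('f, 'r) lang \<Rightarrow> 'a set \<Rightarrow> ('f, 'a) tm \<Rightarrow> bool" where
  "wf_tm L A (Var v) \<longleftrightarrow> True"
| "wf_tm L A (Par c) \<longleftrightarrow> c \<in> A"
| "wf_tm L A (Fn f ts) \<longleftrightarrow>
     f \<in> fun_syms L \<and> length ts = fun_arity L f \<and> (\<forall>t\<in>set ts. wf_tm L A t)"

fun wf_fm :: "('f, 'r) lang \<Rightarrow> 'a set \<Rightarrow> ('f, 'r, 'a) fm \<Rightarrow> bool" where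
  "wf_fm L A (Eq s t) \<longleftrightarrow> wf_tm L A s \<and> wf_tm L A t"
| "wf_fm L A (Rel r ts) \<longleftrightarrow>
     r \<in> rel_syms L \<and> length ts = rel_arity L r \<and> (\<forall>t\<in>set ts. wf_tm L A t)"
| "wf_fm L A (Neg \<psi>) \<longleftrightarrow> wf_fm L A \<psi>"
| "wf_fm L A (And \<psi> \<theta>) \<longleftrightarrow> wf_fm L A \<psi> \<and> wf_fm L A \<theta>"
| "wf_fm L A (Ex v \<psi>) \<longleftrightarrow> wf_fm L A \<psi>"

fun fv_tm :: "('f, 'a) tm \<Rightarrow> nat set" where
  "fv_tm (Var v) = {v}"
| "fv_tm (Par c) = {}"
| "fv_tm (Fn f ts) = (\<Union>t\<in>set ts. fv_tm t)"

fun fv :: "('f, 'r, 'a) fm \<Rightarrow> nat set" where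
  "fv (Eq s t) = fv_tm s \<union> fv_tm t"
| "fv (Rel r ts) = (\<Union>t\<in>set ts. fv_tm t)"
| "fv (Neg \<psi>) = fv \<psi>"
| "fv (And \<psi> \<theta>) = fv \<psi> \<union> fv \<theta>"
| "fv (Ex v \<psi>) = fv \<psi> - {v}"

definition formulas :: "('f, 'r) lang \<Rightarrow> 'a set \<Rightarrow> nat set \<Rightarrow> ('f, 'r, 'a) fm set" where
  "formulas L A V = {\<psi>. wf_fm L A \<psi> \<and> fv \<psi> \<subseteq> V}"

abbreviation sentences :: "('f, 'r) lang \<Rightarrow> ('f, 'r, 'a) fm set" where
  "sentences L \<equiv> formulas L {} {}"

text \<open>Substitution of parameters for free variables; parameters are closed terms, so no capture
  can occur.\<close>

fun subst_tm :: "(nat \<Rightarrow> 'a option) \<Rightarrow> ('f, 'a) tm \<Rightarrow> ('f, 'a) tm" where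
  "subst_tm m (Var v) = (case m v of None \<Rightarrow> Var v | Some c \<Rightarrow> Par c)"
| "subst_tm m (Par c) = Par c"
| "subst_tm m (Fn f ts) = Fn f (map (subst_tm m) ts)"

fun subst_fm :: "(nat \<Rightarrow> 'a option) \<Rightarrow> ('f, 'r, 'a) fm \<Rightarrow> ('f, 'r, 'a) fm" where
  "subst_fm m (Eq s t) = Eq (subst_tm m s) (subst_tm m t)"
| "subst_fm m (Rel r ts) = Rel r (map (subst_tm m) ts)"
| "subst_fm m (Neg \<psi>) = Neg (subst_fm m \<psi>)"
| "subst_fm m (And \<psi> \<theta>) = And (subst_fm m \<psi>) (subst_fm m \<theta>)"
| "subst_fm m (Ex v \<psi>) = Ex v (subst_fm (m(v := None)) \<psi>)"

text \<open>\<open>inst y b \<phi>\<close> is $\phi(x;b)$: the tuple \<open>b\<close> replaces the tuple of variables \<open>y\<close>.\<close>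

definition inst :: "nat list \<Rightarrow> 'a list \<Rightarrow> ('f, 'r, 'a) fm \<Rightarrow> ('f, 'r, 'a) fm" where
  "inst y b \<phi> = subst_fm (map_of (zip y b)) \<phi>"


section \<open>Structures and satisfaction\<close>

record ('f, 'r, 'a) struc =
  univ :: "'a set"
  fun_int :: "'f \<Rightarrow> 'a list \<Rightarrow> 'a"
  rel_int :: "'r \<Rightarrow> 'a list \<Rightarrow> bool"

definition is_struc :: "('f, 'r) lang \<Rightarrow> ('f, 'r, 'a) struc \<Rightarrow> bool" where
  "is_struc L N \<longleftrightarrow> univ N \<noteq> {} \<and>
     (\<forall>f\<in>fun_syms L. \<forall>as. length as = fun_arity L f \<and> set as \<subseteq> univ N \<longrightarrow> fun_int N f as \<in> univ N)"

fun eval_tm :: "('f, 'r, 'a) struc \<Rightarrow> (nat \<Rightarrow> 'a) \<Rightarrow> ('f, 'a) tm \<Rightarrow> 'a" where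
  "eval_tm N e (Var v) = e v"
| "eval_tm N e (Par c) = c"
| "eval_tm N e (Fn f ts) = fun_int N f (map (eval_tm N e) ts)"

fun sat :: "('f, 'r, 'a) struc \<Rightarrow> (nat \<Rightarrow> 'a) \<Rightarrow> ('f, 'r, 'a) fm \<Rightarrow> bool" where
  "sat N e (Eq s t) \<longleftrightarrow> eval_tm N e s = eval_tm N e t"
| "sat N e (Rel r ts) \<longleftrightarrow> rel_int N r (map (eval_tm N e) ts)"
| "sat N e (Neg \<psi>) \<longleftrightarrow> \<not> sat N e \<psi>"
| "sat N e (And \<psi> \<theta>) \<longleftrightarrow> sat N e \<psi> \<and> sat N e \<theta>"
| "sat N e (Ex v \<psi>) \<longleftrightarrow> (\<exists>c\<in>univ N. sat N (e(v := c)) \<psi>)"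

definition tuples :: "('f, 'r, 'a) struc \<Rightarrow> nat list \<Rightarrow> 'a list set" where
  "tuples N v = {a. length a = length v \<and> set a \<subseteq> univ N}"

text \<open>\<open>sat_at N v a \<psi>\<close> is $N \models \psi(a)$, where \<open>a\<close> interprets the tuple of variables \<open>v\<close>.  It is
  only used when the free variables of \<open>\<psi>\<close> are among \<open>v\<close>, so the default value is irrelevant.\<close>

definition sat_at :: "('f, 'r, 'a) struc \<Rightarrow> nat list \<Rightarrow> 'a list \<Rightarrow> ('f, 'r, 'a) fm \<Rightarrow> bool" where
  "sat_at N v a \<psi> \<longleftrightarrow>
     sat N (\<lambda>i. case map_of (zip v a) i of Some c \<Rightarrow> c | None \<Rightarrow> undefined) \<psi>"

definition models :: "('f, 'r, 'a) struc \<Rightarrow> ('f, 'r, 'a) fm set \<Rightarrow> bool" where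
  "models N T \<longleftrightarrow> (\<forall>\<psi>\<in>T. sat_at N [] [] \<psi>)"

text \<open>A complete theory is a maximal satisfiable set of sentences; satisfiability is not repeated
  here, as complete theories are only considered together with a model.  Since every symbol of
  \<open>L\<close> occurs in \<open>T\<close>, the cardinality of \<open>T\<close> as a set is the usual $|T| = |L| + \aleph_0$.\<close>

definition complete_theory :: "('f, 'r) lang \<Rightarrow> ('f, 'r, 'a) fm set \<Rightarrow> bool" where
  "complete_theory L T \<longleftrightarrow> T \<subseteq> sentences L \<and> (\<forall>\<psi>\<in>sentences L. \<psi> \<in> T \<or> Neg \<psi> \<in> T)"

text \<open>Agreement of the interpretations of the symbols follows by considering atomic formulas.\<close>

definition elem_substruc ::
  "('f, 'r) lang \<Rightarrow> ('f, 'r, 'a) struc \<Rightarrow> ('f, 'r, 'a) struc \<Rightarrow> bool" where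
  "elem_substruc L M N \<longleftrightarrow> is_struc L M \<and> is_struc L N \<and> univ M \<subseteq> univ N \<and>
     (\<forall>\<psi> e. wf_fm L {} \<psi> \<and> range e \<subseteq> univ M \<longrightarrow> (sat M e \<psi> \<longleftrightarrow> sat N e \<psi>))"


section \<open>Types\<close>

text \<open>Consistency of a set of formulas in the variables \<open>v\<close> with parameters in \<open>U\<close> is relative to the
  elementary diagram of \<open>U\<close>, that is, finite satisfiability in \<open>U\<close>.\<close>

definition consistent ::
  "('f, 'r, 'a) struc \<Rightarrow> nat list \<Rightarrow> ('f, 'r, 'a) fm set \<Rightarrow> bool" where
  "consistent U v p \<longleftrightarrow> (\<forall>P\<subseteq>p. finite P \<longrightarrow> (\<exists>a\<in>tuples U v. \<forall>\<psi>\<in>P. sat_at U v a \<psi>))"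

definition max_consistent ::
  "('f, 'r, 'a) struc \<Rightarrow> nat list \<Rightarrow> ('f, 'r, 'a) fm set \<Rightarrow> ('f, 'r, 'a) fm set \<Rightarrow> bool" where
  "max_consistent U v \<Delta> p \<longleftrightarrow> p \<subseteq> \<Delta> \<and> consistent U v p \<and>
     (\<forall>p'. p \<subseteq> p' \<and> p' \<subseteq> \<Delta> \<and> consistent U v p' \<longrightarrow> p' = p)"

definition entails ::
  "('f, 'r, 'a) struc \<Rightarrow> nat list \<Rightarrow> ('f, 'r, 'a) fm set \<Rightarrow> ('f, 'r, 'a) fm \<Rightarrow> bool" where
  "entails U v p \<psi> \<longleftrightarrow>
     (\<exists>P\<subseteq>p. finite P \<and> (\<forall>a\<in>tuples U v. (\<forall>\<theta>\<in>P. sat_at U v a \<theta>) \<longrightarrow> sat_at U v a \<psi>))"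

definition realizations ::
  "('f, 'r, 'a) struc \<Rightarrow> nat list \<Rightarrow> ('f, 'r, 'a) fm set \<Rightarrow> 'a list set" where
  "realizations U v q = {b \<in> tuples U v. \<forall>\<psi>\<in>q. sat_at U v b \<psi>}"

definition types ::
  "('f, 'r) lang \<Rightarrow> ('f, 'r, 'a) struc \<Rightarrow> 'a set \<Rightarrow> nat list \<Rightarrow> ('f, 'r, 'a) fm set set" where
  "types L U A v = {q. max_consistent U v (formulas L A (set v)) q}"

definition tp ::
  "('f, 'r) lang \<Rightarrow> ('f, 'r, 'a) struc \<Rightarrow> 'a set \<Rightarrow> nat list \<Rightarrow> 'a list \<Rightarrow> ('f, 'r, 'a) fm set" where
  "tp L U A v b = {\<psi> \<in> formulas L A (set v). sat_at U v b \<psi>}"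

definition stone_space ::
  "('f, 'r) lang \<Rightarrow> ('f, 'r, 'a) struc \<Rightarrow> 'a set \<Rightarrow> nat list \<Rightarrow> ('f, 'r, 'a) fm set topology" where
  "stone_space L U A v =
     topology_generated_by ((\<lambda>\<psi>. {q \<in> types L U A v. \<psi> \<in> q}) ` formulas L A (set v))"


section \<open>Monster models\<close>

text \<open>Here \<open>\<mu>\<close> is a cardinal, represented by a well-order as in the cardinals library.\<close>

definition saturated ::
  "('f, 'r) lang \<Rightarrow> 'l rel \<Rightarrow> ('f, 'r, 'a) struc \<Rightarrow> bool" where
  "saturated L \<mu> U \<longleftrightarrow>
     (\<forall>A v q. A \<subseteq> univ U \<and> |A| <o \<mu> \<and> distinct v \<and> q \<in> types L U A v \<longrightarrow> realizations U v q \<noteq> {})"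

definition partial_elementary ::
  "('f, 'r) lang \<Rightarrow> ('f, 'r, 'a) struc \<Rightarrow> 'a set \<Rightarrow> ('a \<Rightarrow> 'a) \<Rightarrow> bool" where
  "partial_elementary L U A g \<longleftrightarrow> A \<subseteq> univ U \<and> g ` A \<subseteq> univ U \<and>
     (\<forall>\<psi> e. wf_fm L {} \<psi> \<and> range e \<subseteq> A \<longrightarrow> (sat U e \<psi> \<longleftrightarrow> sat U (g \<circ> e) \<psi>))"

definition automorphism :: "('f, 'r) lang \<Rightarrow> ('f, 'r, 'a) struc \<Rightarrow> ('a \<Rightarrow> 'a) \<Rightarrow> bool" where
  "automorphism L U \<sigma> \<longleftrightarrow> bij_betw \<sigma> (univ U) (univ U) \<and>
     (\<forall>f\<in>fun_syms L. \<forall>as. length as = fun_arity L f \<and> set as \<subseteq> univ U \<longrightarrow>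
        \<sigma> (fun_int U f as) = fun_int U f (map \<sigma> as)) \<and>
     (\<forall>r\<in>rel_syms L. \<forall>as. length as = rel_arity L r \<and> set as \<subseteq> univ U \<longrightarrow>
        (rel_int U r as \<longleftrightarrow> rel_int U r (map \<sigma> as)))"

definition strongly_homogeneous ::
  "('f, 'r) lang \<Rightarrow> 'l rel \<Rightarrow> ('f, 'r, 'a) struc \<Rightarrow> bool" where
  "strongly_homogeneous L \<mu> U \<longleftrightarrow>
     (\<forall>A g. |A| <o \<mu> \<and> partial_elementary L U A g \<longrightarrow>
        (\<exists>\<sigma>. automorphism L U \<sigma> \<and> (\<forall>a\<in>A. \<sigma> a = g a)))"

definition monster_model ::
  "('f, 'r) lang \<Rightarrow> ('f, 'r, 'a) fm set \<Rightarrow> 'l rel \<Rightarrow> ('f, 'r, 'a) struc \<Rightarrow> bool" where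
  "monster_model L T \<mu> U \<longleftrightarrow>
     is_struc L U \<and> models U T \<and> saturated L \<mu> U \<and> strongly_homogeneous L \<mu> U"


section \<open>NIP formulas and invariant \<open>\<phi>\<close>-types\<close>

text \<open>A partitioned L-formula $\phi(x;y)$ is a formula \<open>\<phi>\<close> together with tuples of variables \<open>x\<close>, \<open>y\<close>.\<close>

definition partitioned_formula ::
  "('f, 'r) lang \<Rightarrow> ('f, 'r, 'a) fm \<Rightarrow> nat list \<Rightarrow> nat list \<Rightarrow> bool" where
  "partitioned_formula L \<phi> x y \<longleftrightarrow> distinct (x @ y) \<and> \<phi> \<in> formulas L {} (set x \<union> set y)"

definition NIP ::
  "('f, 'r, 'a) struc \<Rightarrow> ('f, 'r, 'a) fm \<Rightarrow> nat list \<Rightarrow> nat list \<Rightarrow> bool" where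
  "NIP U \<phi> x y \<longleftrightarrow>
     \<not> (\<exists>A\<subseteq>tuples U x. infinite A \<and>
          (\<forall>I\<subseteq>A. \<exists>b\<in>tuples U y. \<forall>a\<in>A. sat_at U x a (inst y b \<phi>) \<longleftrightarrow> a \<in> I))"

definition phi_types ::
  "('f, 'r, 'a) struc \<Rightarrow> ('f, 'r, 'a) fm \<Rightarrow> nat list \<Rightarrow> nat list \<Rightarrow> ('f, 'r, 'a) fm set set" where
  "phi_types U \<phi> x y =
     {p. max_consistent U x
           ((\<lambda>b. inst y b \<phi>) ` tuples U y \<union> (\<lambda>b. Neg (inst y b \<phi>)) ` tuples U y) p}"

definition inv_phi_types ::
  "('f, 'r) lang \<Rightarrow> ('f, 'r, 'a) struc \<Rightarrow> 'a set \<Rightarrow> ('f, 'r, 'a) fm \<Rightarrow> nat list \<Rightarrow> nat list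
     \<Rightarrow> ('f, 'r, 'a) fm set set" where
  "inv_phi_types L U A \<phi> x y =
     {p \<in> phi_types U \<phi> x y. \<forall>b\<in>tuples U y. \<forall>b'\<in>tuples U y. tp L U A y b = tp L U A y b' \<longrightarrow>
        (entails U x p (inst y b \<phi>) \<longleftrightarrow> entails U x p (inst y b' \<phi>))}"

definition d_fun ::
  "('f, 'r, 'a) struc \<Rightarrow> ('f, 'r, 'a) fm \<Rightarrow> nat list \<Rightarrow> nat list \<Rightarrow> ('f, 'r, 'a) fm set
     \<Rightarrow> ('f, 'r, 'a) fm set \<Rightarrow> nat" where
  "d_fun U \<phi> x y p q = (if \<exists>b\<in>realizations U y q. entails U x p (inst y b \<phi>) then 1 else 0)"


section \<open>The function classes $B^{\S}$ and $B_r^{\S}$\<close>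

text \<open>A function on the space \<open>X\<close> is a total function whose values outside \<open>topspace X\<close> are
  disregarded.\<close>

definition B_sec :: "'b topology \<Rightarrow> ('b \<Rightarrow> nat) set" where
  "B_sec X = {f \<in> topspace X \<rightarrow> {0, 1}.
     X interior_of (X closure_of {t \<in> topspace X. f t = 0} \<inter> X closure_of {t \<in> topspace X. f t = 1}) = {}}"

definition Br_sec :: "'b topology \<Rightarrow> ('b \<Rightarrow> nat) set" where
  "Br_sec X = {f \<in> topspace X \<rightarrow> {0, 1}.
     \<forall>F. closedin X F \<and> F \<noteq> {} \<longrightarrow> f \<in> B_sec (subtopology X F)}"

end

theory Submission
  imports Defs "HOL-Library.Countable_Set_Type"
begin

text \<open>Suppose that \<open>d_p\<close> fails to lie in $B_r^{\S}$.  Then there is a non-empty set \<open>F\<close> of types over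
  \<open>M\<close> in which both fibres \<open>d_p = 0\<close> and \<open>d_p = 1\<close> are dense (\<open>not_Br_sec_imp_dense_fibres\<close>), and an infinite shattered set is built
  one tuple at a time, contradicting NIP.

  Call a set \<open>S\<close> of \<open>x\<close>-tuples freely cutting \<open>F\<close> if every \<open>q \<in> F\<close> is consistent with every
  assignment of truth values to the formulas \<open>\<phi>(a;y)\<close>, \<open>a \<in> S\<close>.  The heart of the proof is that a
  finite freely cutting \<open>S\<close> can be enlarged by a new tuple \<open>a\<close> (\<open>freely_cuts_extend\<close>).  If \<open>a\<close> realizes \<open>p\<close> over enough
  parameters, the set of \<open>q \<in> F\<close> consistent with a given pattern on \<open>S\<close> and with \<open>\<phi>(a;y)\<close> is
  relatively closed and contains all \<open>q \<in> F\<close> with \<open>d_p(q) = 1\<close>: such a \<open>q\<close> has a realization \<open>b\<close> with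
  the given pattern on \<open>S\<close>, and by \<open>M\<close>-invariance \<open>p\<close> contains \<open>\<phi>(x;b)\<close>.  By density it is all of \<open>F\<close>.
  The negation \<open>\<not>\<phi>(a;y)\<close> is treated in the same way with the fibre \<open>d_p = 0\<close>.

  Instead of realizing \<open>p\<close> over a large set of such \<open>b\<close>, the conditions on \<open>a\<close> are written as
  formulas $\exists y\,(\psi(y) \wedge \ldots \wedge \pm\phi(x;y))$ over \<open>M\<close> and \<open>S\<close>.  Finitely many of
  them involve only finitely many witnesses \<open>b\<close>, so finite satisfiability of \<open>p\<close> applies, and
  saturation of the monster model produces \<open>a\<close>.  In the end the union of the finite sets is countable,
  and saturation over \<open>M\<close> and this union realizes arbitrary infinite patterns
  (\<open>freely_cuts_realization\<close>).\<close>

section \<open>Evaluation of formulas\<close>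

definition override :: "(nat \<Rightarrow> 'a option) \<Rightarrow> (nat \<Rightarrow> 'a) \<Rightarrow> nat \<Rightarrow> 'a" where
  "override m e i = (case m i of Some c \<Rightarrow> c | None \<Rightarrow> e i)"

lemma sat_at_override:
  "sat_at N v a \<psi> \<longleftrightarrow> sat N (override (map_of (zip v a)) (\<lambda>_. undefined)) \<psi>"
  unfolding sat_at_def override_def by simp

lemma override_map_of_zip_notin:
  "i \<notin> set v \<Longrightarrow> override (map_of (zip v a)) e i = e i"
proof -
  assume "i \<notin> set v"
  then have "map_of (zip v a) i = None"
    by (metis in_set_zipE map_of_eq_None_iff imageE prod.collapse)
  then show ?thesis by (simp add: override_def)
qed

lemma override_override: "override m (override m' e) = override (m' ++ m) e"
  by (rule ext) (simp add: override_def map_add_def split: option.split)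

lemma override_zip_append:
  assumes "distinct (x @ y)" "length a = length x"
  shows "override (map_of (zip (x @ y) (a @ b))) e
    = override (map_of (zip y b)) (override (map_of (zip x a)) e)"
proof -
  have "dom (map_of (zip x a)) \<subseteq> set x" "dom (map_of (zip y b)) \<subseteq> set y"
    by (auto dest!: map_of_SomeD dest: set_zip_leftD)
  then have "dom (map_of (zip x a)) \<inter> dom (map_of (zip y b)) = {}"
    using assms(1) by auto
  then show ?thesis
    using assms(2)
    by (simp add: override_override map_add_comm[of "map_of (zip x a)"] del: dom_map_of_zip)
qed

lemma eval_tm_cong:
  "(\<And>i. i \<in> fv_tm t \<Longrightarrow> e i = e' i) \<Longrightarrow> eval_tm N e t = eval_tm N e' t"
proof (induction t)
  case (Fn f ts)
  have "map (eval_tm N e) ts = map (eval_tm N e') ts"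
    by (rule map_cong[OF refl], rule Fn.IH) (use Fn.prems in auto)
  then show ?case by (metis eval_tm.simps(3))
qed auto

lemma sat_cong:
  "(\<And>i. i \<in> fv \<psi> \<Longrightarrow> e i = e' i) \<Longrightarrow> sat N e \<psi> \<longleftrightarrow> sat N e' \<psi>"
proof (induction \<psi> arbitrary: e e')
  case (Eq s t)
  then show ?case by (simp add: eval_tm_cong[of s e e'] eval_tm_cong[of t e e'])
next
  case (Rel r ts)
  have "map (eval_tm N e) ts = map (eval_tm N e') ts"
    by (rule map_cong[OF refl], rule eval_tm_cong) (use Rel.prems in auto)
  then show ?case by (metis sat.simps(2))
next
  case (Neg \<psi>)
  then show ?case by (metis fv.simps(3) sat.simps(3))
next
  case (And \<psi> \<theta>)
  then show ?case by (metis Un_iff fv.simps(4) sat.simps(4))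
next
  case (Ex v \<psi>)
  have "sat N (e(v := c)) \<psi> \<longleftrightarrow> sat N (e'(v := c)) \<psi>" for c
    by (rule Ex.IH) (use Ex.prems in auto)
  then show ?case by simp
qed

lemma eval_subst_tm: "eval_tm N e (subst_tm m t) = eval_tm N (override m e) t"
proof (induction t)
  case (Fn f ts)
  then have "map (eval_tm N e \<circ> subst_tm m) ts = map (eval_tm N (override m e)) ts" by simp
  then show ?case by (metis eval_tm.simps(3) map_map subst_tm.simps(3))
qed (auto simp: override_def split: option.splits)

lemma sat_subst_fm: "sat N e (subst_fm m \<psi>) \<longleftrightarrow> sat N (override m e) \<psi>"
proof (induction \<psi> arbitrary: e m)
  case (Rel r ts)
  have "eval_tm N e \<circ> subst_tm m = eval_tm N (override m e)"
    by (rule ext) (simp add: eval_subst_tm)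
  then show ?case by simp
next
  case (Ex v \<psi>)
  have "override (m(v := None)) (e(v := c)) = (override m e)(v := c)" for c
    by (rule ext) (simp add: override_def split: option.split)
  then show ?case by (simp only: sat.simps subst_fm.simps Ex.IH)
qed (auto simp: eval_subst_tm)

lemma sat_at_inst:
  assumes "distinct (x @ y)" "a \<in> tuples N x"
  shows "sat_at N x a (inst y b \<phi>) \<longleftrightarrow> sat_at N (x @ y) (a @ b) \<phi>"
proof -
  have "length a = length x" using assms(2) by (simp add: tuples_def)
  then show ?thesis
    by (simp only: sat_at_override inst_def sat_subst_fm override_zip_append[OF assms(1)])
qed

text \<open>Patterns are recorded by the formulas \<open>\<phi>(x;b)\<close>, whereas a realization of a type in \<open>y\<close> is
  found by imposing \<open>\<phi>(a;y)\<close>; this translates between the two.\<close>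

lemma sat_at_inst_swap:
  assumes "distinct (x @ y)" "a \<in> tuples N x" "b \<in> tuples N y"
  shows "sat_at N y b (inst x a \<phi>) \<longleftrightarrow> sat_at N x a (inst y b \<phi>)"
proof -
  have len: "length x = length a" "length y = length b" using assms by (simp_all add: tuples_def)
  have "map_of (zip (y @ x) (b @ a)) = map_of (zip (x @ y) (a @ b))"
    using assms(1) len by (simp add: map_add_comm Int_commute)
  moreover have "distinct (y @ x)" using assms(1) by auto
  ultimately show ?thesis
    using sat_at_inst[of y x b N a \<phi>] sat_at_inst[of x y a N b \<phi>] assms
    by (simp add: sat_at_override del: zip_append)
qed

lemma sat_at_append_right:
  assumes "distinct (x @ y)" "a \<in> tuples N x" "b \<in> tuples N y" "fv \<psi> \<subseteq> set y"
  shows "sat_at N (x @ y) (a @ b) \<psi> \<longleftrightarrow> sat_at N y b \<psi>"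
proof -
  have len: "length a = length x" "length b = length y" using assms(2,3) by (simp_all add: tuples_def)
  show ?thesis
    unfolding sat_at_override override_zip_append[OF assms(1) len(1)]
  proof (rule sat_cong)
    fix i assume "i \<in> fv \<psi>"
    then have "i \<in> dom (map_of (zip y b))" using assms(4) len(2) by auto
    then show "override (map_of (zip y b)) (override (map_of (zip x a)) (\<lambda>_. undefined)) i
        = override (map_of (zip y b)) (\<lambda>_. undefined) i"
      by (auto simp: override_def)
  qed
qed

lemma sat_foldr_Ex:
  assumes "distinct y"
  shows "sat N e (foldr Ex y \<rho>) \<longleftrightarrow> (\<exists>b\<in>tuples N y. sat N (override (map_of (zip y b)) e) \<rho>)"
  using assms
proof (induction y arbitrary: e)
  case Nil
  then show ?case by (simp add: tuples_def override_def)
next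
  case (Cons v y)
  have eq: "override (map_of (zip y b)) (e(v := c)) = override (map_of (zip (v # y) (c # b))) e" for b c
    using Cons.prems override_map_of_zip_notin[of v y b]
    by (intro ext) (auto simp: override_def split: option.splits)
  have "tuples N (v # y) = {c # b | c b. c \<in> univ N \<and> b \<in> tuples N y}"
  proof (rule set_eqI)
    fix a show "a \<in> tuples N (v # y) \<longleftrightarrow> a \<in> {c # b | c b. c \<in> univ N \<and> b \<in> tuples N y}"
      by (cases a) (auto simp: tuples_def)
  qed
  then show ?case using Cons by (auto simp: eq simp del: zip_Cons_Cons)
qed

lemma sat_foldr_And: "sat N e (foldr And \<psi>s \<rho>) \<longleftrightarrow> (\<forall>\<psi>\<in>set \<psi>s. sat N e \<psi>) \<and> sat N e \<rho>"
  by (induction \<psi>s) auto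

definition lit :: "bool \<Rightarrow> ('f, 'r, 'a) fm \<Rightarrow> ('f, 'r, 'a) fm" where
  "lit s \<psi> = (if s then \<psi> else Neg \<psi>)"

lemma sat_at_lit: "sat_at N v a (lit s \<psi>) \<longleftrightarrow> (sat_at N v a \<psi> \<longleftrightarrow> s)"
  by (simp add: lit_def sat_at_def)


section \<open>Membership in sets of formulas\<close>

lemma formulas_mono:
  fixes L :: "('f, 'r) lang" and \<psi> :: "('f, 'r, 'a) fm"
  shows "A \<subseteq> A' \<Longrightarrow> V \<subseteq> V' \<Longrightarrow> \<psi> \<in> formulas L A V \<Longrightarrow> \<psi> \<in> formulas L A' V'"
proof -
  assume "A \<subseteq> A'"
  then have tm: "wf_tm L A t \<Longrightarrow> wf_tm L A' t" for t :: "('f, 'a) tm"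
    by (induction t) auto
  have "wf_fm L A \<psi> \<Longrightarrow> wf_fm L A' \<psi>" for \<psi> :: "('f, 'r, 'a) fm"
    by (induction \<psi>) (auto intro: tm)
  then show "V \<subseteq> V' \<Longrightarrow> \<psi> \<in> formulas L A V \<Longrightarrow> \<psi> \<in> formulas L A' V'"
    by (auto simp: formulas_def)
qed

lemma lit_formulas: "\<psi> \<in> formulas L A V \<Longrightarrow> lit s \<psi> \<in> formulas L A V"
  by (simp add: formulas_def lit_def)

lemma foldr_And_formulas:
  "set \<psi>s \<subseteq> formulas L A V \<Longrightarrow> \<rho> \<in> formulas L A V \<Longrightarrow> foldr And \<psi>s \<rho> \<in> formulas L A V"
  by (induction \<psi>s) (auto simp: formulas_def)

lemma foldr_Ex_formulas:
  "\<rho> \<in> formulas L A (V \<union> set y) \<Longrightarrow> foldr Ex y \<rho> \<in> formulas L A V"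
proof (induction y arbitrary: V)
  case (Cons v y)
  then have "foldr Ex y \<rho> \<in> formulas L A (insert v V)" by simp
  then show ?case by (auto simp: formulas_def)
qed simp

lemma wf_subst_tm: "wf_tm L A t \<Longrightarrow> ran m \<subseteq> A \<Longrightarrow> wf_tm L A (subst_tm m t)"
  by (induction t) (auto simp: ran_def split: option.splits)

lemma wf_subst_fm: "wf_fm L A \<psi> \<Longrightarrow> ran m \<subseteq> A \<Longrightarrow> wf_fm L A (subst_fm m \<psi>)"
proof (induction \<psi> arbitrary: m)
  case (Ex v \<psi>)
  have "ran (m(v := None)) \<subseteq> A" using Ex.prems(2) by (auto simp: ran_def)
  then show ?case using Ex by simp
qed (auto intro: wf_subst_tm)

lemma fv_subst_tm: "fv_tm (subst_tm m t) = fv_tm t - dom m"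
  by (induction t) (auto split: option.splits)

lemma fv_subst_fm: "fv (subst_fm m \<psi>) = fv \<psi> - dom m"
  by (induction \<psi> arbitrary: m) (auto simp: fv_subst_tm)

lemma inst_formulas:
  assumes "\<phi> \<in> formulas L {} (set x \<union> set y)" "length a = length x" "set a \<subseteq> A"
  shows "inst x a \<phi> \<in> formulas L A (set y)"
proof -
  have "wf_fm L A \<phi>" "fv \<phi> \<subseteq> set x \<union> set y"
    using formulas_mono[OF _ _ assms(1), of A "set x \<union> set y"] by (auto simp: formulas_def)
  moreover have "ran (map_of (zip x a)) \<subseteq> A"
    using assms(3) by (auto simp: ran_def dest!: map_of_SomeD dest: set_zip_rightD)
  moreover have "dom (map_of (zip x a)) = set x" using assms(2) by simp
  ultimately show ?thesis by (auto simp: formulas_def inst_def wf_subst_fm fv_subst_fm)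
qed


section \<open>Consistent sets and saturation\<close>

lemma consistent_extends_to_max:
  assumes "consistent U v \<Gamma>" "\<Gamma> \<subseteq> \<Delta>"
  shows "\<exists>q. \<Gamma> \<subseteq> q \<and> max_consistent U v \<Delta> q"
proof -
  let ?A = "{q. \<Gamma> \<subseteq> q \<and> q \<subseteq> \<Delta> \<and> consistent U v q}"
  have "\<exists>q\<in>?A. \<forall>X\<in>?A. q \<subseteq> X \<longrightarrow> X = q"
  proof (rule subset_Zorn_nonempty)
    show "?A \<noteq> {}" using assms by blast
  next
    fix C assume C: "C \<noteq> {}" "subset.chain ?A C"
    then have sub: "C \<subseteq> ?A" by (simp add: subset.chain_def)
    have "consistent U v (\<Union>C)"
      unfolding consistent_def
    proof (intro allI impI)
      fix P assume "P \<subseteq> \<Union>C" "finite P"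
      then obtain q where "q \<in> C" "P \<subseteq> q"
        using finite_subset_Union_chain[OF _ _ C] by metis
      then show "\<exists>a\<in>tuples U v. \<forall>\<psi>\<in>P. sat_at U v a \<psi>"
        using sub \<open>finite P\<close> by (auto simp: consistent_def)
    qed
    then show "\<Union>C \<in> ?A" using sub C(1) by blast
  qed
  then obtain q where "q \<in> ?A" "\<forall>X\<in>?A. q \<subseteq> X \<longrightarrow> X = q" by blast
  then have "\<Gamma> \<subseteq> q \<and> max_consistent U v \<Delta> q" unfolding max_consistent_def by blast
  then show ?thesis by blast
qed

text \<open>Saturation speaks of complete types, and the conditions that arise below form partial types; a
  maximal consistent extension bridges the two.\<close>

lemma saturated_realizes_consistent:
  assumes "saturated L \<mu> U" "A \<subseteq> univ U" "|A| <o \<mu>" "distinct v"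
    and "\<Gamma> \<subseteq> formulas L A (set v)" "consistent U v \<Gamma>"
  shows "\<exists>b\<in>tuples U v. \<forall>\<psi>\<in>\<Gamma>. sat_at U v b \<psi>"
proof -
  obtain q where q: "\<Gamma> \<subseteq> q" "q \<in> types L U A v"
    using consistent_extends_to_max[OF assms(6,5)] unfolding types_def by blast
  then have "realizations U v q \<noteq> {}" using assms by (auto simp: saturated_def)
  then show ?thesis using q(1) by (auto simp: realizations_def)
qed

lemma tp_eq_type:
  assumes "q \<in> types L U A v" "b \<in> realizations U v q"
  shows "tp L U A v b = q"
proof -
  have "q \<subseteq> tp L U A v b"
    using assms by (auto simp: types_def max_consistent_def realizations_def tp_def)
  moreover have "consistent U v (tp L U A v b)"
    using assms(2) by (auto simp: consistent_def realizations_def tp_def)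
  ultimately show ?thesis
    using assms(1) by (auto simp: types_def max_consistent_def tp_def)
qed

lemma max_consistent_decides:
  assumes p: "max_consistent U v \<Delta> p" and "\<psi> \<in> \<Delta>" "Neg \<psi> \<in> \<Delta>"
  shows "\<psi> \<in> p \<or> Neg \<psi> \<in> p"
proof (rule ccontr)
  assume not: "\<not> (\<psi> \<in> p \<or> Neg \<psi> \<in> p)"
  have clash: "\<exists>P\<subseteq>p. finite P \<and> (\<forall>a\<in>tuples U v. (\<forall>\<theta>\<in>P. sat_at U v a \<theta>) \<longrightarrow> \<not> sat_at U v a \<theta>')"
    if "\<theta>' \<in> \<Delta>" "\<theta>' \<notin> p" for \<theta>'
  proof -
    have "\<not> consistent U v (insert \<theta>' p)"
      using p that unfolding max_consistent_def by blast
    then obtain P where P: "P \<subseteq> insert \<theta>' p" "finite P"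
      "\<forall>a\<in>tuples U v. \<exists>\<theta>\<in>P. \<not> sat_at U v a \<theta>"
      unfolding consistent_def by auto
    have "P - {\<theta>'} \<subseteq> p" "finite (P - {\<theta>'})" using P(1,2) by auto
    moreover have "\<forall>a\<in>tuples U v. (\<forall>\<theta>\<in>P - {\<theta>'}. sat_at U v a \<theta>) \<longrightarrow> \<not> sat_at U v a \<theta>'"
      using P(3) by blast
    ultimately show ?thesis by blast
  qed
  obtain P where P: "P \<subseteq> p" "finite P"
    "\<forall>a\<in>tuples U v. (\<forall>\<theta>\<in>P. sat_at U v a \<theta>) \<longrightarrow> \<not> sat_at U v a \<psi>"
    using clash assms(2) not by blast
  obtain Q where Q: "Q \<subseteq> p" "finite Q"
    "\<forall>a\<in>tuples U v. (\<forall>\<theta>\<in>Q. sat_at U v a \<theta>) \<longrightarrow> \<not> sat_at U v a (Neg \<psi>)"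
    using clash assms(3) not by blast
  have "\<exists>a\<in>tuples U v. \<forall>\<theta>\<in>P \<union> Q. sat_at U v a \<theta>"
    using p P Q unfolding max_consistent_def consistent_def by (meson finite_UnI le_sup_iff)
  then show False using P(3) Q(3) by (auto simp: sat_at_def)
qed

lemma phi_type_contains_entailed_literal:
  assumes "p \<in> phi_types U \<phi> x y" "b \<in> tuples U y"
  shows "lit (entails U x p (inst y b \<phi>)) (inst y b \<phi>) \<in> p"
proof -
  let ?\<psi> = "inst y b \<phi>"
  have mc: "max_consistent U x
      ((\<lambda>b. inst y b \<phi>) ` tuples U y \<union> (\<lambda>b. Neg (inst y b \<phi>)) ` tuples U y) p"
    using assms(1) by (simp add: phi_types_def)
  have dec: "?\<psi> \<in> p \<or> Neg ?\<psi> \<in> p"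
    by (rule max_consistent_decides[OF mc]) (use assms(2) in auto)
  have pos: "entails U x p ?\<psi>" if "?\<psi> \<in> p"
    unfolding entails_def by (rule exI[of _ "{?\<psi>}"]) (use that in auto)
  have neg: "\<not> entails U x p ?\<psi>" if n: "Neg ?\<psi> \<in> p"
  proof
    assume "entails U x p ?\<psi>"
    then obtain P where P: "P \<subseteq> p" "finite P"
      "\<forall>a\<in>tuples U x. (\<forall>\<theta>\<in>P. sat_at U x a \<theta>) \<longrightarrow> sat_at U x a ?\<psi>"
      unfolding entails_def by blast
    have "insert (Neg ?\<psi>) P \<subseteq> p" "finite (insert (Neg ?\<psi>) P)" using P n by auto
    then have "\<exists>a\<in>tuples U x. \<forall>\<theta>\<in>insert (Neg ?\<psi>) P. sat_at U x a \<theta>"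
      using mc unfolding max_consistent_def consistent_def by blast
    then show False using P(3) by (auto simp: sat_at_def)
  qed
  show ?thesis using dec pos neg by (auto simp: lit_def)
qed

text \<open>Invariance makes the value of \<open>d_p\<close> at \<open>q\<close> visible at every realization of \<open>q\<close>, in
  particular at those found later with a prescribed \<open>\<phi>\<close>-pattern.\<close>

lemma d_fun_decides_realizations:
  assumes p: "p \<in> inv_phi_types L U A \<phi> x y" and q: "q \<in> types L U A y"
    and b: "b \<in> realizations U y q"
  shows "lit (d_fun U \<phi> x y p q = 1) (inst y b \<phi>) \<in> p"
proof -
  have inv: "entails U x p (inst y b' \<phi>) \<longleftrightarrow> entails U x p (inst y b \<phi>)"
    if "b' \<in> realizations U y q" for b'
    using p b that tp_eq_type[OF q b] tp_eq_type[OF q that]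
    unfolding inv_phi_types_def realizations_def by blast
  have "(\<exists>b'\<in>realizations U y q. entails U x p (inst y b' \<phi>)) \<longleftrightarrow> entails U x p (inst y b \<phi>)"
    using inv b by (metis (no_types))
  then have "d_fun U \<phi> x y p q = 1 \<longleftrightarrow> entails U x p (inst y b \<phi>)"
    by (simp add: d_fun_def)
  then show ?thesis
    using phi_type_contains_entailed_literal[of p U \<phi> x y b] p b
    by (simp add: inv_phi_types_def realizations_def)
qed


section \<open>Sets on which both values are dense\<close>

text \<open>The witness is the interior of the intersection of the two closures, taken inside the closed
  subspace \<open>F\<close> where $B^{\S}$ fails.  Being open in \<open>F\<close>, it turns an open set meeting it into an open
  set of \<open>F\<close>, which meets both fibres.\<close>

lemma not_Br_sec_imp_dense_fibres:
  assumes f: "f \<in> topspace X \<rightarrow> {0, 1}" and "f \<notin> Br_sec X"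
  obtains G where "G \<subseteq> topspace X" "G \<noteq> {}"
    "\<And>V s. openin X V \<Longrightarrow> V \<inter> G \<noteq> {} \<Longrightarrow> \<exists>t\<in>V \<inter> G. (f t = 1) = s"
proof -
  obtain F where F: "closedin X F" "f \<notin> B_sec (subtopology X F)"
    using assms unfolding Br_sec_def by blast
  define Y where "Y = subtopology X F"
  define G where "G = Y interior_of
    (Y closure_of {t \<in> topspace Y. f t = 0} \<inter> Y closure_of {t \<in> topspace Y. f t = 1})"
  have topY: "topspace Y = F" using closedin_subset[OF F(1)] by (auto simp: Y_def)
  have FX: "F \<subseteq> topspace X" using closedin_subset[OF F(1)] .
  have "f \<in> topspace Y \<rightarrow> {0, 1}" using f FX topY by blast
  then have "G \<noteq> {}" using F(2) by (simp add: B_sec_def G_def Y_def)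
  moreover have oG: "openin Y G" unfolding G_def by simp
  then have "G \<subseteq> topspace X" using openin_subset topY FX by blast
  moreover have "\<exists>t\<in>V \<inter> G. (f t = 1) = s" if V: "openin X V" "V \<inter> G \<noteq> {}" for V s
  proof -
    have "openin Y (V \<inter> F)" unfolding Y_def using V(1) by (auto simp: openin_subtopology)
    then have o: "openin Y ((V \<inter> F) \<inter> G)" using oG by (rule openin_Int)
    obtain t where t: "t \<in> V \<inter> G" using V by blast
    have tF: "t \<in> F" using t oG openin_subset topY by blast
    have "t \<in> Y closure_of {t \<in> topspace Y. f t = (if s then 1 else 0)}"
      using t interior_of_subset[of Y] unfolding G_def by (cases s) auto
    moreover have "t \<in> (V \<inter> F) \<inter> G" using t tF by simp
    ultimately obtain u where "u \<in> {t \<in> topspace Y. f t = (if s then 1 else 0)}" "u \<in> (V \<inter> F) \<inter> G"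
      using o unfolding in_closure_of by meson
    then show ?thesis by (intro bexI[of _ u]) (auto split: if_splits)
  qed
  ultimately show ?thesis using that by blast
qed

lemma topspace_stone_space_subset: "topspace (stone_space L U A v) \<subseteq> types L U A v"
  unfolding stone_space_def topology_generated_by_topspace by auto

text \<open>Finite sets of formulas are used as basic neighbourhoods, which spares the passage to
  conjunctions.\<close>

lemma openin_stone_space_finite:
  assumes "finite P" "P \<subseteq> formulas L A (set v)"
  shows "openin (stone_space L U A v) {q \<in> topspace (stone_space L U A v). P \<subseteq> q}"
  using assms
proof (induction P)
  case empty
  then show ?case by simp
next
  case (insert \<psi> P)
  let ?X = "stone_space L U A v"
  have "openin ?X {q \<in> types L U A v. \<psi> \<in> q}"
    unfolding stone_space_def using insert.prems by (intro topology_generated_by_Basis) auto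
  then have "openin ?X ({q \<in> types L U A v. \<psi> \<in> q} \<inter> {q \<in> topspace ?X. P \<subseteq> q})"
    using insert by (intro openin_Int) auto
  moreover have "{q \<in> types L U A v. \<psi> \<in> q} \<inter> {q \<in> topspace ?X. P \<subseteq> q}
      = {q \<in> topspace ?X. insert \<psi> P \<subseteq> q}"
    using topspace_stone_space_subset[of L U A v] by auto
  ultimately show ?case by simp
qed


section \<open>Freely cutting sets\<close>

text \<open>Consistency of a type with a pattern is unfolded to finite parts of both, because in this form it
  evidently passes to unions of chains.\<close>

definition freely_cuts ::
  "('f, 'r, 'a) struc \<Rightarrow> ('f, 'r, 'a) fm \<Rightarrow> nat list \<Rightarrow> nat list
     \<Rightarrow> 'a list set \<Rightarrow> ('f, 'r, 'a) fm set set \<Rightarrow> bool" where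
  "freely_cuts U \<phi> x y S F \<longleftrightarrow> S \<subseteq> tuples U x \<and>
     (\<forall>q\<in>F. \<forall>P K I. P \<subseteq> q \<and> finite P \<and> K \<subseteq> S \<and> finite K \<longrightarrow>
        (\<exists>b\<in>tuples U y. (\<forall>\<psi>\<in>P. sat_at U y b \<psi>) \<and>
           (\<forall>a\<in>K. sat_at U x a (inst y b \<phi>) \<longleftrightarrow> a \<in> I)))"

lemma freely_cutsE:
  assumes "freely_cuts U \<phi> x y S F" "q \<in> F" "P \<subseteq> q" "finite P" "K \<subseteq> S" "finite K"
  obtains b where "b \<in> tuples U y" "\<forall>\<psi>\<in>P. sat_at U y b \<psi>"
    "\<forall>a\<in>K. sat_at U x a (inst y b \<phi>) \<longleftrightarrow> a \<in> I"
proof -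
  have "\<exists>b\<in>tuples U y. (\<forall>\<psi>\<in>P. sat_at U y b \<psi>) \<and> (\<forall>a\<in>K. sat_at U x a (inst y b \<phi>) \<longleftrightarrow> a \<in> I)"
    using assms(1)[unfolded freely_cuts_def, THEN conjunct2, rule_format, of q P K I] assms(2-6)
    by simp
  then show ?thesis using that by (elim bexE conjE)
qed

lemma freely_cuts_empty:
  assumes "F \<subseteq> types L U A y"
  shows "freely_cuts U \<phi> x y {} F"
proof -
  have "\<exists>b\<in>tuples U y. \<forall>\<psi>\<in>P. sat_at U y b \<psi>" if "q \<in> F" "P \<subseteq> q" "finite P" for q P
  proof -
    have "consistent U y q" using assms that(1) by (auto simp: types_def max_consistent_def)
    then show ?thesis using that(2,3) by (simp add: consistent_def)
  qed
  then show ?thesis by (simp add: freely_cuts_def)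
qed

lemma freely_cuts_Union_chain:
  fixes S :: "nat \<Rightarrow> 'a list set"
  assumes cut: "\<And>n. freely_cuts U \<phi> x y (S n) F" and inc: "\<And>n. S n \<subseteq> S (Suc n)"
  shows "freely_cuts U \<phi> x y (\<Union>n. S n) F"
  unfolding freely_cuts_def
proof (intro conjI ballI allI impI)
  show "(\<Union>n. S n) \<subseteq> tuples U x" using cut unfolding freely_cuts_def by blast
next
  fix q P K I
  assume q: "q \<in> F" and "P \<subseteq> q \<and> finite P \<and> K \<subseteq> (\<Union>n. S n) \<and> finite K"
  then have P: "P \<subseteq> q" "finite P" and K: "K \<subseteq> (\<Union>n. S n)" "finite K" by auto
  have mono: "S m \<subseteq> S n" if "m \<le> n" for m n using lift_Suc_mono_le[of S, OF inc that] .
  have "\<exists>n. K \<subseteq> S n"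
    using K(2,1)
  proof (induction K)
    case (insert a K)
    then obtain m n where "a \<in> S m" "K \<subseteq> S n" by auto
    then have "insert a K \<subseteq> S (max m n)" using mono[of m "max m n"] mono[of n "max m n"] by auto
    then show ?case by blast
  qed simp
  then obtain n where "K \<subseteq> S n" by blast
  then show "\<exists>b\<in>tuples U y. (\<forall>\<psi>\<in>P. sat_at U y b \<psi>) \<and> (\<forall>a\<in>K. sat_at U x a (inst y b \<phi>) \<longleftrightarrow> a \<in> I)"
    by (metis freely_cutsE[OF cut[of n] q P _ K(2)])
qed

text \<open>Compactness turns the finitary condition into genuine realizations of \<open>q\<close> with any pattern on \<open>S\<close>.\<close>

lemma freely_cuts_realization:
  assumes sat: "saturated L \<mu> U" and A: "A \<subseteq> univ U" and card: "|A \<union> (\<Union>a\<in>S. set a)| <o \<mu>"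
    and part: "partitioned_formula L \<phi> x y"
    and F: "F \<subseteq> types L U A y" and cut: "freely_cuts U \<phi> x y S F" and q: "q \<in> F"
  shows "\<exists>b\<in>realizations U y q. \<forall>a\<in>S. sat_at U x a (inst y b \<phi>) \<longleftrightarrow> a \<in> I"
proof -
  let ?B = "A \<union> (\<Union>a\<in>S. set a)"
  let ?c = "\<lambda>a. lit (a \<in> I) (inst x a \<phi>)"
  have dis: "distinct (x @ y)" and \<phi>: "\<phi> \<in> formulas L {} (set x \<union> set y)"
    using part by (auto simp: partitioned_formula_def)
  have S: "S \<subseteq> tuples U x" using cut by (simp add: freely_cuts_def)
  have swap: "sat_at U y b (?c a) \<longleftrightarrow> (sat_at U x a (inst y b \<phi>) \<longleftrightarrow> a \<in> I)"
    if "a \<in> S" "b \<in> tuples U y" for a b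
    using sat_at_inst_swap[OF dis, of a U b \<phi>] that S by (simp add: sat_at_lit subset_iff)
  have cons: "consistent U y (q \<union> ?c ` S)"
    unfolding consistent_def
  proof (intro allI impI)
    fix P assume P: "P \<subseteq> q \<union> ?c ` S" "finite P"
    have "finite (P - q)" "P - q \<subseteq> ?c ` S" using P by auto
    from finite_subset_image[OF this] obtain K where K: "K \<subseteq> S" "finite K" "P - q = ?c ` K"
      by auto
    have "P \<inter> q \<subseteq> q" "finite (P \<inter> q)" using P(2) by auto
    then obtain b where b: "b \<in> tuples U y" "\<forall>\<psi>\<in>P \<inter> q. sat_at U y b \<psi>"
      "\<forall>a\<in>K. sat_at U x a (inst y b \<phi>) \<longleftrightarrow> a \<in> I"
      by (rule freely_cutsE[OF cut q _ _ K(1,2)])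
    have "\<forall>\<psi>\<in>P - q. sat_at U y b \<psi>"
    proof
      fix \<psi> assume "\<psi> \<in> P - q"
      then obtain a where a: "a \<in> K" "\<psi> = ?c a" unfolding K(3) by (elim imageE)
      have "a \<in> S" using a(1) K(1) by (rule rev_subsetD)
      show "sat_at U y b \<psi>" unfolding a(2) swap[OF \<open>a \<in> S\<close> b(1)] using b(3) a(1) by simp
    qed
    then show "\<exists>b\<in>tuples U y. \<forall>\<psi>\<in>P. sat_at U y b \<psi>" using b by blast
  qed
  have "q \<subseteq> formulas L A (set y)" using q F by (auto simp: types_def max_consistent_def)
  then have "q \<subseteq> formulas L ?B (set y)" using formulas_mono[of A ?B "set y" "set y"] by blast
  moreover have "?c ` S \<subseteq> formulas L ?B (set y)"
    using S by (auto simp: tuples_def intro!: lit_formulas inst_formulas[OF \<phi>])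
  moreover have "?B \<subseteq> univ U" using A S by (auto simp: tuples_def)
  ultimately obtain b where "b \<in> tuples U y" "\<forall>\<psi>\<in>q \<union> ?c ` S. sat_at U y b \<psi>"
    using saturated_realizes_consistent[OF sat _ card _ _ cons] dis by auto
  then show ?thesis using swap by (intro bexI[of _ b]) (auto simp: realizations_def)
qed

text \<open>The formula saying of \<open>x\<close> that some \<open>y\<close> satisfies the finitely many formulas \<open>ps\<close>, has the
  pattern \<open>I\<close> on the tuples \<open>ss\<close> and gives \<open>\<phi>(x;y)\<close> the truth value \<open>s\<close>.\<close>

definition cut_fm ::
  "('f, 'r, 'a) fm \<Rightarrow> nat list \<Rightarrow> nat list \<Rightarrow> 'a list list
     \<Rightarrow> ('f, 'r, 'a) fm list \<Rightarrow> 'a list set \<Rightarrow> bool \<Rightarrow> ('f, 'r, 'a) fm" where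
  "cut_fm \<phi> x y ss ps I s =
     foldr Ex y (foldr And (ps @ map (\<lambda>a. lit (a \<in> I) (inst x a \<phi>)) ss) (lit s \<phi>))"

lemma cut_fm_formulas:
  assumes part: "partitioned_formula L \<phi> x y"
    and ss: "set ss \<subseteq> tuples U x" and ps: "set ps \<subseteq> formulas L A (set y)"
  shows "cut_fm \<phi> x y ss ps I s \<in> formulas L (A \<union> (\<Union>a\<in>set ss. set a)) (set x)"
  unfolding cut_fm_def
proof (intro foldr_Ex_formulas foldr_And_formulas lit_formulas)
  let ?B = "A \<union> (\<Union>a\<in>set ss. set a)"
  have \<phi>: "\<phi> \<in> formulas L {} (set x \<union> set y)" using part by (simp add: partitioned_formula_def)
  show "\<phi> \<in> formulas L ?B (set x \<union> set y)" by (rule formulas_mono[OF _ _ \<phi>]) auto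
  have "lit (a \<in> I) (inst x a \<phi>) \<in> formulas L ?B (set x \<union> set y)" if "a \<in> set ss" for a
  proof -
    have "inst x a \<phi> \<in> formulas L ?B (set y)"
      using that ss by (intro inst_formulas[OF \<phi>]) (auto simp: tuples_def)
    then show ?thesis
      using formulas_mono[of ?B ?B "set y" "set x \<union> set y"] lit_formulas by blast
  qed
  moreover have "set ps \<subseteq> formulas L ?B (set x \<union> set y)"
    using ps formulas_mono[of A ?B "set y" "set x \<union> set y"] by blast
  ultimately show "set (ps @ map (\<lambda>a. lit (a \<in> I) (inst x a \<phi>)) ss)
      \<subseteq> formulas L ?B (set x \<union> set y)"
    by auto
qed

lemma sat_at_cut_fm:
  assumes part: "partitioned_formula L \<phi> x y"
    and ss: "set ss \<subseteq> tuples U x" and ps: "set ps \<subseteq> formulas L A (set y)" and a: "a \<in> tuples U x"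
  shows "sat_at U x a (cut_fm \<phi> x y ss ps I s) \<longleftrightarrow>
    (\<exists>b\<in>tuples U y. (\<forall>\<psi>\<in>set ps. sat_at U y b \<psi>) \<and>
       (\<forall>c\<in>set ss. sat_at U x c (inst y b \<phi>) \<longleftrightarrow> c \<in> I) \<and>
       (sat_at U x a (inst y b \<phi>) \<longleftrightarrow> s))"
proof -
  have dis: "distinct (x @ y)" and \<phi>: "\<phi> \<in> formulas L {} (set x \<union> set y)"
    using part by (auto simp: partitioned_formula_def)
  have ex: "sat_at U x a (foldr Ex y \<rho>) \<longleftrightarrow> (\<exists>b\<in>tuples U y. sat_at U x a (inst y b \<rho>))" for \<rho>
    using dis by (simp add: sat_at_override sat_foldr_Ex inst_def sat_subst_fm)
  have conj: "sat_at U v b (foldr And \<psi>s \<rho>) \<longleftrightarrow> (\<forall>\<psi>\<in>set \<psi>s. sat_at U v b \<psi>) \<and> sat_at U v b \<rho>"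
    for v b \<psi>s \<rho>
    by (simp add: sat_at_override sat_foldr_And)
  have psy: "sat_at U (x @ y) (a @ b) \<psi> \<longleftrightarrow> sat_at U y b \<psi>"
    if "\<psi> \<in> set ps" "b \<in> tuples U y" for \<psi> b
    using that ps by (intro sat_at_append_right[OF dis a]) (auto simp: formulas_def)
  have ssy: "sat_at U (x @ y) (a @ b) (inst x c \<phi>) \<longleftrightarrow> sat_at U x c (inst y b \<phi>)"
    if "c \<in> set ss" "b \<in> tuples U y" for c b
  proof -
    have c: "c \<in> tuples U x" using that ss by blast
    then have "inst x c \<phi> \<in> formulas L (set c) (set y)"
      by (intro inst_formulas[OF \<phi>]) (auto simp: tuples_def)
    then show ?thesis
      using sat_at_append_right[OF dis a that(2)] sat_at_inst_swap[OF dis c that(2)]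
      by (auto simp: formulas_def)
  qed
  show ?thesis
    unfolding cut_fm_def ex sat_at_inst[OF dis a] conj
    by (intro bex_cong refl) (simp add: ball_Un psy ssy sat_at_lit)
qed

text \<open>The inductive step of the construction.  For each sign \<open>s\<close> and each basic open set meeting
  \<open>F\<close>, density supplies a type in it with value \<open>s\<close>, free cutting supplies a realization \<open>b\<close> of this
  type with the given pattern on \<open>S\<close>, and \<open>p\<close> contains \<open>\<phi>(x;b)\<close> or its negation according to \<open>s\<close>.
  As \<open>p\<close> is finitely satisfiable, finitely many of these members of \<open>p\<close> have a common solution,
  and it satisfies the corresponding existential conditions.\<close>

lemma freely_cuts_extend:
  assumes sat: "saturated L \<mu> U" and A: "A \<subseteq> univ U" and card: "|A \<union> (\<Union>a\<in>S. set a)| <o \<mu>"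
    and part: "partitioned_formula L \<phi> x y" and p: "p \<in> inv_phi_types L U A \<phi> x y"
    and F: "F \<subseteq> types L U A y" "F \<noteq> {}"
    and dense: "\<And>q P s. q \<in> F \<Longrightarrow> P \<subseteq> q \<Longrightarrow> finite P \<Longrightarrow>
      \<exists>q'\<in>F. P \<subseteq> q' \<and> (d_fun U \<phi> x y p q' = 1) = s"
    and S: "finite S" and cut: "freely_cuts U \<phi> x y S F"
  shows "\<exists>a. a \<notin> S \<and> freely_cuts U \<phi> x y (insert a S) F"
proof -
  let ?\<Phi> = "\<lambda>a b. sat_at U x a (inst y b \<phi>)"
  obtain ss where ss: "set ss = S" using finite_list[OF S] by blast
  have SU: "S \<subseteq> tuples U x" using cut by (simp add: freely_cuts_def)
  have disx: "distinct x" using part by (simp add: partitioned_formula_def)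
  have ps: "set ps \<subseteq> formulas L A (set y)" if "q \<in> F" "set ps \<subseteq> q" for q ps
    using that F by (auto simp: types_def max_consistent_def)
  define \<Theta> where "\<Theta> = {cut_fm \<phi> x y ss ps I s | ps I s. \<exists>q\<in>F. set ps \<subseteq> q}"
  have sat_\<Theta>: "sat_at U x a (cut_fm \<phi> x y ss ps I s) \<longleftrightarrow>
    (\<exists>b\<in>tuples U y. (\<forall>\<psi>\<in>set ps. sat_at U y b \<psi>) \<and> (\<forall>c\<in>S. ?\<Phi> c b \<longleftrightarrow> c \<in> I) \<and> (?\<Phi> a b \<longleftrightarrow> s))"
    if "q \<in> F" "set ps \<subseteq> q" "a \<in> tuples U x" for q ps a I s
    using sat_at_cut_fm[OF part, of ss U ps A a I s] ps[OF that(1,2)] that(3) SU ss by simp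
  have "\<exists>\<theta>'\<in>p. \<forall>a\<in>tuples U x. sat_at U x a \<theta>' \<longrightarrow> sat_at U x a \<theta>"
    if \<theta>_in: "\<theta> \<in> \<Theta>" for \<theta>
  proof -
    obtain q ps I s where \<theta>: "\<theta> = cut_fm \<phi> x y ss ps I s" and q: "q \<in> F" "set ps \<subseteq> q"
      using \<theta>_in unfolding \<Theta>_def by blast
    obtain q' where q': "q' \<in> F" "set ps \<subseteq> q'" "(d_fun U \<phi> x y p q' = 1) = s"
      using dense[OF q finite_set, of s] by metis
    obtain b where b: "b \<in> realizations U y q'" "\<forall>c\<in>S. ?\<Phi> c b \<longleftrightarrow> c \<in> I"
      using freely_cuts_realization[OF sat A card part F(1) cut q'(1)] by blast
    have "lit s (inst y b \<phi>) \<in> p"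
      using d_fun_decides_realizations[OF p _ b(1)] q' F(1) by auto
    moreover have "sat_at U x a \<theta>" if "a \<in> tuples U x" "sat_at U x a (lit s (inst y b \<phi>))" for a
      unfolding \<theta> sat_\<Theta>[OF q that(1)]
      using b that(2) q'(2) by (intro bexI[of _ b]) (auto simp: realizations_def sat_at_lit)
    ultimately show ?thesis by blast
  qed
  then obtain w where w: "\<And>\<theta>. \<theta> \<in> \<Theta> \<Longrightarrow> w \<theta> \<in> p"
    "\<And>\<theta> a. \<theta> \<in> \<Theta> \<Longrightarrow> a \<in> tuples U x \<Longrightarrow> sat_at U x a (w \<theta>) \<Longrightarrow> sat_at U x a \<theta>"
    by metis
  have "consistent U x p"
    using p by (simp add: inv_phi_types_def phi_types_def max_consistent_def)
  then have fin: "\<exists>a\<in>tuples U x. \<forall>\<theta>\<in>P. sat_at U x a \<theta>" if "P \<subseteq> p" "finite P" for P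
    using that unfolding consistent_def by blast
  have "consistent U x \<Theta>"
    unfolding consistent_def
  proof (intro allI impI)
    fix P assume P: "P \<subseteq> \<Theta>" "finite P"
    obtain a where "a \<in> tuples U x" "\<forall>\<theta>\<in>w ` P. sat_at U x a \<theta>"
      using fin[of "w ` P"] P w(1) by auto
    then show "\<exists>a\<in>tuples U x. \<forall>\<theta>\<in>P. sat_at U x a \<theta>" using w(2) P(1) by blast
  qed
  moreover have "\<Theta> \<subseteq> formulas L (A \<union> (\<Union>a\<in>S. set a)) (set x)"
  proof
    fix \<theta> assume "\<theta> \<in> \<Theta>"
    then obtain q pl I s where "\<theta> = cut_fm \<phi> x y ss pl I s" and "q \<in> F" "set pl \<subseteq> q"
      unfolding \<Theta>_def by blast
    then show "\<theta> \<in> formulas L (A \<union> (\<Union>a\<in>S. set a)) (set x)"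
      using cut_fm_formulas[OF part, of ss U pl A I s] ps SU ss by simp
  qed
  moreover have "A \<union> (\<Union>a\<in>S. set a) \<subseteq> univ U" using A SU by (auto simp: tuples_def)
  ultimately obtain a where a: "a \<in> tuples U x" "\<forall>\<theta>\<in>\<Theta>. sat_at U x a \<theta>"
    using saturated_realizes_consistent[OF sat _ card disx] by blast
  have wit: "\<exists>b\<in>tuples U y. (\<forall>\<psi>\<in>P. sat_at U y b \<psi>) \<and> (\<forall>c\<in>S. ?\<Phi> c b \<longleftrightarrow> c \<in> I) \<and> (?\<Phi> a b \<longleftrightarrow> s)"
    if q: "q \<in> F" "P \<subseteq> q" and P: "finite P" for q P I s
  proof -
    obtain pl where pl: "set pl = P" using finite_list[OF P] by blast
    then have sub: "set pl \<subseteq> q" using q(2) by simp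
    then have "cut_fm \<phi> x y ss pl I s \<in> \<Theta>" using q(1) unfolding \<Theta>_def by blast
    then have "sat_at U x a (cut_fm \<phi> x y ss pl I s)" using a(2) by simp
    then show ?thesis unfolding sat_\<Theta>[OF q(1) sub a(1)] pl .
  qed
  \<comment> \<open>If \<open>a\<close> were in \<open>S\<close>, the contradictory demands \<open>a \<notin> I\<close> and \<open>s = True\<close> could be met.\<close>
  have "a \<notin> S"
  proof
    assume "a \<in> S"
    obtain q where "q \<in> F" using F(2) by blast
    then show False using wit[of q "{}" "{}" True] \<open>a \<in> S\<close> by auto
  qed
  moreover have "freely_cuts U \<phi> x y (insert a S) F"
    unfolding freely_cuts_def
  proof (intro conjI ballI allI impI)
    show "insert a S \<subseteq> tuples U x" using a(1) SU by simp
  next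
    fix q P K I
    assume q: "q \<in> F" and "P \<subseteq> q \<and> finite P \<and> K \<subseteq> insert a S \<and> finite K"
    then show "\<exists>b\<in>tuples U y. (\<forall>\<psi>\<in>P. sat_at U y b \<psi>) \<and> (\<forall>a\<in>K. ?\<Phi> a b \<longleftrightarrow> a \<in> I)"
      using wit[OF q, of P I "a \<in> I"] by blast
  qed
  ultimately show ?thesis by blast
qed


section \<open>Infinite shattering contradicts NIP\<close>

theorem theorem2p10:
  fixes \<kappa> :: "'k rel" and \<mu> :: "'l rel"
    and L :: "('f, 'r) lang" and T :: "('f, 'r, 'a) fm set"
    and U M :: "('f, 'r, 'a) struc"
    and \<phi> :: "('f, 'r, 'a) fm" and x y :: "nat list"
    and p :: "('f, 'r, 'a) fm set"
  assumes "Cinfinite \<kappa>"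
    and "complete_theory L T"
    and "Card_order \<mu>" and "\<kappa> <o \<mu>"
    and "monster_model L T \<mu> U"
    and "elem_substruc L M U"
    and "|univ M| \<le>o \<kappa>" and "|T| \<le>o \<kappa>"
    and "partitioned_formula L \<phi> x y"
    and "NIP U \<phi> x y"
    and "p \<in> inv_phi_types L U (univ M) \<phi> x y"
  shows "d_fun U \<phi> x y p \<in> Br_sec (stone_space L U (univ M) y)"
proof (rule ccontr)
  let ?A = "univ M"
  let ?X = "stone_space L U ?A y"
  let ?d = "d_fun U \<phi> x y p"
  assume "?d \<notin> Br_sec ?X"
  moreover have "?d \<in> topspace ?X \<rightarrow> {0, 1}" by (auto simp: d_fun_def)
  ultimately obtain F where F: "F \<subseteq> topspace ?X" "F \<noteq> {}"
    and dense_open: "\<And>V s. openin ?X V \<Longrightarrow> V \<inter> F \<noteq> {} \<Longrightarrow> \<exists>q\<in>V \<inter> F. (?d q = 1) = s"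
    using not_Br_sec_imp_dense_fibres by blast
  have Ft: "F \<subseteq> types L U ?A y" using F(1) topspace_stone_space_subset by blast
  have dense: "\<exists>q'\<in>F. P \<subseteq> q' \<and> (?d q' = 1) = s" if "q \<in> F" "P \<subseteq> q" "finite P" for q P s
  proof -
    let ?V = "{q \<in> topspace ?X. P \<subseteq> q}"
    have "P \<subseteq> formulas L ?A (set y)"
      using that Ft by (auto simp: types_def max_consistent_def)
    then have "openin ?X ?V" by (rule openin_stone_space_finite[OF that(3)])
    moreover have "?V \<inter> F \<noteq> {}" using that(1,2) F(1) by blast
    ultimately have "\<exists>q'\<in>?V \<inter> F. (?d q' = 1) = s" by (rule dense_open)
    then show ?thesis by blast
  qed
  have sat: "saturated L \<mu> U" using assms(5) by (simp add: monster_model_def)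
  have A: "?A \<subseteq> univ U" using assms(6) by (simp add: elem_substruc_def)
  \<comment> \<open>Countably many parameters may be added to \<open>M\<close> without leaving the range of saturation.\<close>
  have card: "|?A \<union> (\<Union>a\<in>S. set a)| <o \<mu>" if "countable S" for S :: "'a list set"
  proof -
    have "countable (\<Union>a\<in>S. set a)" using that by (simp add: countable_finite)
    then have "|\<Union>a\<in>S. set a| \<le>o natLeq"
      using countable_card_le_natLeq by blast
    then have "|\<Union>a\<in>S. set a| \<le>o \<kappa>"
      using natLeq_ordLeq_cinfinite[OF assms(1)] ordLeq_transitive by blast
    then have "|?A \<union> (\<Union>a\<in>S. set a)| \<le>o \<kappa>"
      using Un_Cinfinite_bound[OF assms(7) _ assms(1)] by blast
    then show ?thesis using assms(4) by (rule ordLeq_ordLess_trans)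
  qed
  \<comment> \<open>The cardinality \<open>n\<close> is carried along so that the union of the chain is infinite.\<close>
  define Q where "Q n S \<longleftrightarrow> finite S \<and> card S = n \<and> freely_cuts U \<phi> x y S F" for n S
  have "Q 0 {}" using freely_cuts_empty[OF Ft] by (simp add: Q_def)
  then have base: "\<exists>S. Q 0 S" by (rule exI)
  have step: "\<exists>S'. Q (Suc n) S' \<and> S \<subseteq> S'" if S: "Q n S" for S n
  proof -
    have fin: "finite S" and cut: "freely_cuts U \<phi> x y S F" using S by (simp_all add: Q_def)
    have "\<exists>a. a \<notin> S \<and> freely_cuts U \<phi> x y (insert a S) F"
      by (rule freely_cuts_extend[OF sat A card[OF countable_finite[OF fin]] assms(9,11) Ft F(2) _ fin cut])
        (rule dense)
    then obtain a where a: "a \<notin> S" "freely_cuts U \<phi> x y (insert a S) F" by blast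
    then have "Q (Suc n) (insert a S)" using S by (simp add: Q_def)
    then show ?thesis using subset_insertI by (intro exI conjI)
  qed
  obtain S where "\<And>n. Q n (S n)" and inc: "\<And>n. S n \<subseteq> S (Suc n)"
    using dependent_nat_choice[of Q "\<lambda>_ S S'. S \<subseteq> S'", OF base step] by metis
  then have S: "finite (S n)" "card (S n) = n" "freely_cuts U \<phi> x y (S n) F" for n
    unfolding Q_def by simp_all
  let ?S = "\<Union>n. S n"
  have cut: "freely_cuts U \<phi> x y ?S F" by (rule freely_cuts_Union_chain[where S = S, OF S(3) inc])
  have "infinite ?S"
  proof
    assume fin: "finite ?S"
    have "Suc (card ?S) \<le> card ?S"
      using card_mono[OF fin, of "S (Suc (card ?S))"] S(2) by auto
    then show False by simp
  qed
  moreover have "?S \<subseteq> tuples U x" using cut by (simp add: freely_cuts_def)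
  moreover have "\<exists>b\<in>tuples U y. \<forall>a\<in>?S. sat_at U x a (inst y b \<phi>) \<longleftrightarrow> a \<in> I" for I
  proof -
    obtain q where "q \<in> F" using F(2) by blast
    have "countable ?S" using S(1) by (intro countable_UN) (auto intro: countable_finite)
    then obtain b where "b \<in> realizations U y q"
      "\<forall>a\<in>?S. sat_at U x a (inst y b \<phi>) \<longleftrightarrow> a \<in> I"
      using freely_cuts_realization[OF sat A card[OF \<open>countable ?S\<close>] assms(9) Ft cut \<open>q \<in> F\<close>] by blast
    then show ?thesis by (auto simp: realizations_def)
  qed
  ultimately have "\<not> NIP U \<phi> x y"
    unfolding NIP_def not_not by (intro exI[of _ ?S] conjI allI impI)
  then show False using assms(10) by (rule notE)
qed

end
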